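(* For every integer $k\ge 1$, there is a $3$-degenerate graph $T_k$ such that $\rho(T_k)\le 2$ and $\gamma(T_k)\ge k$.
   Context: All graphs are finite and simple. A graph $G$ is $d$-degenerate if every subgraph of $G$ has a vertex of degree at most $d$. For a vertex $v$ of a graph $G$, $N_G[v]$ denotes the closed neighborhood of $v$. A dominating set of $G$ is a set of vertices whose closed neighborhoods together cover $V(G)$; $\gamma(G)$ denotes the minimum size of a dominating set. A packing in $G$ is a set of vertices whose closed neighborhoods are pairwise disjoint (equivalently, pairwise at distance at least $3$); $\rho(G)$ denotes the maximum size of a packing. *)

theory Defs
  imports "Graph_Theory.Graph_Theory"
begin

text \<open>
  A finite simple graph is a \<open>pair_graph\<close>: each undirected edge \<open>uv\<close> is represented by the two
  arcs \<open>(u, v)\<close> and \<open>(v, u)\<close>, so \<open>out_degree\<close> is the usual degree. A subgraph that is again a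
  \<open>pair_graph\<close> is a subgraph in the undirected sense (not necessarily induced). The subgraph
  without vertices is excluded below, as otherwise no graph would be degenerate.
\<close>

definition degenerate :: "nat \<Rightarrow> 'a pair_pre_digraph \<Rightarrow> bool" where
  "degenerate d G \<longleftrightarrow>
    (\<forall>H. pair_graph H \<and> subgraph (with_proj H) (with_proj G) \<and> pverts H \<noteq> {} \<longrightarrow>
      (\<exists>v\<in>pverts H. out_degree (with_proj H) v \<le> d))"

definition closed_neighborhood :: "'a pair_pre_digraph \<Rightarrow> 'a \<Rightarrow> 'a set" where
  "closed_neighborhood G v = insert v {u. (v, u) \<in> parcs G}"

definition dominating_set :: "'a pair_pre_digraph \<Rightarrow> 'a set \<Rightarrow> bool" where
  "dominating_set G D \<longleftrightarrow>
    D \<subseteq> pverts G \<and> pverts G \<subseteq> (\<Union>v\<in>D. closed_neighborhood G v)"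

definition packing :: "'a pair_pre_digraph \<Rightarrow> 'a set \<Rightarrow> bool" where
  "packing G P \<longleftrightarrow>
    P \<subseteq> pverts G \<and>
    pairwise (\<lambda>u v. disjnt (closed_neighborhood G u) (closed_neighborhood G v)) P"

text \<open>
  For a finite graph the minimum and the maximum are over finite nonempty sets: \<open>pverts G\<close> is
  dominating and \<open>{}\<close> is a packing.
\<close>

definition domination_number :: "'a pair_pre_digraph \<Rightarrow> nat" where
  "domination_number G = Min (card ` {D. dominating_set G D})"

definition packing_number :: "'a pair_pre_digraph \<Rightarrow> nat" where
  "packing_number G = Max (card ` {P. packing G P})"

end

theory Submission
  imports Defs
begin

text \<open>
  Take independent vertices \<open>0, \<dots>, n - 1\<close>, a further vertex (the hub), and for each pair \<open>(a, b)\<close>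
  of vertices below \<open>n\<close> a vertex (a midpoint) joined to exactly \<open>a\<close>, \<open>b\<close> and the hub.
  Midpoints have degree at most 3 and every edge has an end at a midpoint, so the graph is
  3-degenerate. Two vertices below \<open>n\<close> share a midpoint, while all midpoints and the hub
  contain the hub in their closed neighborhoods; hence a packing has at most one vertex below \<open>n\<close>
  and at most one other vertex. Yet a closed neighborhood contains at most two of the vertices
  below \<open>n\<close>, so a dominating set has at least \<open>n / 2\<close> elements. The theorem follows for
  \<open>n = 2 * k\<close>.
\<close>

text \<open>
  The hub is the number \<open>n\<close>, and the midpoints are numbers greater than \<open>n\<close>. All ordered pairs are
  used, including those with \<open>a = b\<close>, since the extra midpoints do no harm.
\<close>

definition midpoint :: "nat \<Rightarrow> nat \<Rightarrow> nat \<Rightarrow> nat" where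
  "midpoint n a b = Suc n + prod_encode (a, b)"

definition midpoint_arcs :: "nat \<Rightarrow> (nat \<times> nat) set" where
  "midpoint_arcs n = {(midpoint n a b, w) | a b w. a < n \<and> b < n \<and> w \<in> {a, b, n}}"

definition midpoint_graph :: "nat \<Rightarrow> nat pair_pre_digraph" where
  "midpoint_graph n =
    \<lparr>pverts = {..n} \<union> {midpoint n a b | a b. a < n \<and> b < n},
     parcs = midpoint_arcs n \<union> (midpoint_arcs n)\<inverse>\<rparr>"

lemma midpoint_eq_iff [simp]: "midpoint n a b = midpoint n c d \<longleftrightarrow> a = c \<and> b = d"
  by (simp add: midpoint_def)

lemma midpoint_gt [simp]: "n < midpoint n a b"
  by (simp add: midpoint_def)

lemma midpoint_not_le [simp]: "\<not> midpoint n a b \<le> n" "\<not> midpoint n a b < n"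
  by (simp_all add: midpoint_def)

lemma midpoint_neq [simp]:
  assumes "w \<le> n"
  shows "midpoint n a b \<noteq> w" "w \<noteq> midpoint n a b"
  using assms by (auto simp: midpoint_def)

lemma pverts_midpoint_graph_cases:
  assumes "v \<in> pverts (midpoint_graph n)"
  obtains "v < n" | "v = n" | a b where "a < n" "b < n" "v = midpoint n a b"
  using assms by (fastforce simp: midpoint_graph_def)

lemma finite_pverts_midpoint_graph: "finite (pverts (midpoint_graph n))"
proof -
  have "{midpoint n a b | a b. a < n \<and> b < n} = (\<lambda>(a, b). midpoint n a b) ` ({..<n} \<times> {..<n})"
    by auto
  then show ?thesis
    by (simp add: midpoint_graph_def)
qed

lemma arcs_from_midpoint:
  "(midpoint n a b, w) \<in> parcs (midpoint_graph n) \<longleftrightarrow> a < n \<and> b < n \<and> w \<in> {a, b, n}"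
  by (auto simp: midpoint_graph_def midpoint_arcs_def)

lemma arcs_from_le:
  assumes "v \<le> n"
  shows "(v, w) \<in> parcs (midpoint_graph n) \<longleftrightarrow>
    (\<exists>a b. w = midpoint n a b \<and> a < n \<and> b < n \<and> v \<in> {a, b, n})"
proof -
  have "v \<noteq> midpoint n a b" for a b
    using assms by auto
  then show ?thesis
    by (auto simp: midpoint_graph_def midpoint_arcs_def)
qed

lemma pair_graph_midpoint_graph: "pair_graph (midpoint_graph n)"
proof
  fix e
  assume "e \<in> parcs (midpoint_graph n)"
  then show "fst e \<in> pverts (midpoint_graph n)" "snd e \<in> pverts (midpoint_graph n)"
    by (auto simp: midpoint_graph_def midpoint_arcs_def)
  from \<open>e \<in> parcs (midpoint_graph n)\<close> show "fst e \<noteq> snd e"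
    by (auto simp: midpoint_graph_def midpoint_arcs_def)
next
  show "finite (pverts (midpoint_graph n))"
    by (rule finite_pverts_midpoint_graph)
  have "parcs (midpoint_graph n) \<subseteq> pverts (midpoint_graph n) \<times> pverts (midpoint_graph n)"
    by (auto simp: midpoint_graph_def midpoint_arcs_def)
  then show "finite (parcs (midpoint_graph n))"
    by (rule finite_subset) (simp add: finite_pverts_midpoint_graph)
  show "symmetric (with_proj (midpoint_graph n))"
    by (auto simp: symmetric_def sym_def arcs_ends_def arc_to_ends_def midpoint_graph_def)
qed

lemma degenerate_midpoint_graph: "degenerate 3 (midpoint_graph n)"
  unfolding degenerate_def
proof (intro allI impI, elim conjE)
  fix H :: "nat pair_pre_digraph"
  assume sub: "subgraph (with_proj H) (with_proj (midpoint_graph n))" and ne: "pverts H \<noteq> {}"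
  from sub have verts: "pverts H \<subseteq> pverts (midpoint_graph n)"
    and arcs: "parcs H \<subseteq> parcs (midpoint_graph n)"
    by (auto simp: subgraph_def)
  from sub have ends: "w \<in> pverts H" if "(v, w) \<in> parcs H" for v w
    using that by (auto simp: subgraph_def wf_digraph_def)
  have out: "out_arcs (with_proj H) v = Pair v ` {w. (v, w) \<in> parcs H}" for v
    by (auto simp: out_arcs_def)
  show "\<exists>v\<in>pverts H. out_degree (with_proj H) v \<le> 3"
  proof (cases "\<exists>a b. midpoint n a b \<in> pverts H")
    case True
    then obtain a b where ab: "midpoint n a b \<in> pverts H"
      by blast
    have "{w. (midpoint n a b, w) \<in> parcs H} \<subseteq> {a, b, n}"
      using arcs arcs_from_midpoint by blast
    then have "out_arcs (with_proj H) (midpoint n a b) \<subseteq> Pair (midpoint n a b) ` {a, b, n}"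
      unfolding out by (rule image_mono)
    then have "out_degree (with_proj H) (midpoint n a b) \<le> card (Pair (midpoint n a b) ` {a, b, n})"
      unfolding out_degree_def by (rule card_mono[rotated]) simp
    also have "\<dots> \<le> card {a, b, n}"
      by (rule card_image_le) simp
    also have "\<dots> \<le> 3"
      by (simp add: card_insert_if)
    finally show ?thesis
      using ab by blast
  next
    case False
    \<comment> \<open>Without midpoints, no edge is left.\<close>
    from ne obtain v where v: "v \<in> pverts H"
      by blast
    then have "v \<in> pverts (midpoint_graph n)"
      using verts by blast
    then have "v \<le> n"
      using v False by (cases rule: pverts_midpoint_graph_cases) auto
    then have "(v, w) \<notin> parcs H" for w
      using arcs ends[of v w] False arcs_from_le[of v n w] by blast
    then have "out_degree (with_proj H) v = 0"
      by (simp add: out_degree_def out)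
    then show ?thesis
      using v by (intro bexI[of _ v]) simp_all
  qed
qed

lemma card_packing_midpoint_graph:
  assumes "packing (midpoint_graph n) P"
  shows "card P \<le> 2"
proof -
  let ?N = "closed_neighborhood (midpoint_graph n)"
  from assms have sub: "P \<subseteq> pverts (midpoint_graph n)"
    and disj: "pairwise (\<lambda>u v. disjnt (?N u) (?N v)) P"
    by (simp_all add: packing_def)
  have eqI: "u = v" if "u \<in> P" "v \<in> P" "x \<in> ?N u" "x \<in> ?N v" for u v x
    using pairwiseD[OF disj that(1,2)] that(3,4) by (meson disjnt_iff)
  have fin: "finite P"
    using sub finite_pverts_midpoint_graph finite_subset by blast
  have "u = v" if "u \<in> P \<inter> {..<n}" "v \<in> P \<inter> {..<n}" for u v
    by (rule eqI[of _ _ "midpoint n u v"])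
      (use that in \<open>auto simp: closed_neighborhood_def arcs_from_le\<close>)
  then have low: "card (P \<inter> {..<n}) \<le> 1"
    using fin by (auto simp: card_le_Suc0_iff_eq)
  have hub: "n \<in> ?N u" if "u \<in> P - {..<n}" for u
  proof -
    from that sub have "u \<in> pverts (midpoint_graph n)" "\<not> u < n"
      by auto
    then show ?thesis
      by (cases rule: pverts_midpoint_graph_cases)
        (auto simp: closed_neighborhood_def arcs_from_midpoint)
  qed
  have "u = v" if "u \<in> P - {..<n}" "v \<in> P - {..<n}" for u v
    using eqI[of u v n] hub that by blast
  then have high: "card (P - {..<n}) \<le> 1"
    using fin by (auto simp: card_le_Suc0_iff_eq)
  have "card P = card (P \<inter> {..<n}) + card (P - {..<n})"
    using fin by (metis Int_Diff_Un Int_Diff_disjoint card_Un_disjoint finite_Diff finite_Int)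
  then show ?thesis
    using low high by simp
qed

lemma card_dominating_set_midpoint_graph:
  assumes "dominating_set (midpoint_graph n) D"
  shows "n \<le> 2 * card D"
proof -
  let ?N = "closed_neighborhood (midpoint_graph n)"
  from assms have sub: "D \<subseteq> pverts (midpoint_graph n)"
    and cover: "pverts (midpoint_graph n) \<subseteq> (\<Union>v\<in>D. ?N v)"
    by (auto simp: dominating_set_def)
  have fin: "finite D"
    using sub finite_pverts_midpoint_graph finite_subset by blast
  have bound: "finite (?N v \<inter> {..<n}) \<and> card (?N v \<inter> {..<n}) \<le> 2" if "v \<in> D" for v
  proof -
    have "\<exists>a b. ?N v \<inter> {..<n} \<subseteq> {a, b}"
    proof (cases "v \<le> n")
      case True
      then have "?N v \<inter> {..<n} \<subseteq> {v, v}"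
        by (auto simp: closed_neighborhood_def arcs_from_le)
      then show ?thesis
        by blast
    next
      case False
      have "v \<in> pverts (midpoint_graph n)"
        using that sub by blast
      then obtain a b where "v = midpoint n a b"
        using False by (cases rule: pverts_midpoint_graph_cases) auto
      then have "?N v \<inter> {..<n} \<subseteq> {a, b}"
        by (auto simp: closed_neighborhood_def arcs_from_midpoint)
      then show ?thesis
        by blast
    qed
    then obtain a b where ab: "?N v \<inter> {..<n} \<subseteq> {a, b}"
      by blast
    have "card (?N v \<inter> {..<n}) \<le> card {a, b}"
      using ab by (rule card_mono[rotated]) simp
    also have "\<dots> \<le> 2"
      by (simp add: card_insert_if)
    finally show ?thesis
      by simp
  qed
  have "{..<n} \<subseteq> pverts (midpoint_graph n)"
    by (auto simp: midpoint_graph_def)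
  then have "{..<n} \<subseteq> (\<Union>v\<in>D. ?N v \<inter> {..<n})"
    using cover by blast
  then have "card {..<n} \<le> card (\<Union>v\<in>D. ?N v \<inter> {..<n})"
    using fin bound by (intro card_mono) auto
  also have "\<dots> \<le> (\<Sum>v\<in>D. card (?N v \<inter> {..<n}))"
    using fin by (rule card_UN_le)
  also have "\<dots> \<le> (\<Sum>v\<in>D. 2)"
    using bound by (intro sum_mono) blast
  finally show ?thesis
    by simp
qed

lemma packing_number_midpoint_graph: "packing_number (midpoint_graph n) \<le> 2"
proof -
  have "finite {P. packing (midpoint_graph n) P}"
    using finite_pverts_midpoint_graph[of n]
    by (rule finite_subset[rotated, OF finite_Pow_iff[THEN iffD2]]) (auto simp: packing_def)
  moreover have "packing (midpoint_graph n) {}"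
    by (simp add: packing_def)
  ultimately show ?thesis
    unfolding packing_number_def
    by (subst Max_le_iff) (auto simp: card_packing_midpoint_graph)
qed

lemma domination_number_midpoint_graph: "n \<le> 2 * domination_number (midpoint_graph n)"
proof -
  let ?S = "{D. dominating_set (midpoint_graph n) D}"
  have "finite ?S"
    using finite_pverts_midpoint_graph[of n]
    by (rule finite_subset[rotated, OF finite_Pow_iff[THEN iffD2]]) (auto simp: dominating_set_def)
  moreover have "pverts (midpoint_graph n) \<in> ?S"
    by (auto simp: dominating_set_def closed_neighborhood_def)
  ultimately have "domination_number (midpoint_graph n) \<in> card ` ?S"
    unfolding domination_number_def by (intro Min_in) auto
  then show ?thesis
    using card_dominating_set_midpoint_graph by auto
qed

theorem theorem1p14:
  fixes k :: nat
  assumes "k \<ge> 1"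
  shows "\<exists>T :: nat pair_pre_digraph.
    pair_graph T \<and> degenerate 3 T \<and> packing_number T \<le> 2 \<and> domination_number T \<ge> k"
proof (intro exI conjI)
  show "pair_graph (midpoint_graph (2 * k))"
    by (rule pair_graph_midpoint_graph)
  show "degenerate 3 (midpoint_graph (2 * k))"
    by (rule degenerate_midpoint_graph)
  show "packing_number (midpoint_graph (2 * k)) \<le> 2"
    by (rule packing_number_midpoint_graph)
  show "domination_number (midpoint_graph (2 * k)) \<ge> k"
    using domination_number_midpoint_graph[of "2 * k"] by simp
qed

end
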